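(* Let $t\ge 2$ be an integer and let $A$ be a column-$t$-partite zero-one matrix. Then $$\operatorname{ex}(n,A)<n^{2-\frac{1}{t}+\frac{1}{2t^{2}}+o(1)},$$ that is, for every $\varepsilon>0$ there exists $n_0$ such that $\operatorname{ex}(n,A)<n^{2-\frac1t+\frac{1}{2t^2}+\varepsilon}$ for all $n\ge n_0$.
   Context: A zero-one matrix $M$ contains a zero-one matrix $A$ if one can delete some rows and columns of $M$ and turn some $1$-entries into $0$-entries so that the resulting matrix is $A$. The weight $w(M)$ is the number of $1$-entries of $M$. The extremal number $\operatorname{ex}(n,A)$ is the maximum weight of an $n\times n$ zero-one matrix that does not contain $A$. A matrix $A$ is column-$t$-partite if its columns can be cut into $t$ consecutive intervals, giving $t$ submatrices, such that every row of each of these submatrices contains at most one $1$-entry. *)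

theory Defs
  imports "HOL-Analysis.Analysis"
begin

text \<open>A zero-one matrix with k rows and l columns is represented by a predicate
  on indices; only entries (i,j) with i < k, j < l are meaningful.\<close>

definition contains :: "nat \<Rightarrow> nat \<Rightarrow> (nat \<Rightarrow> nat \<Rightarrow> bool) \<Rightarrow>
                         nat \<Rightarrow> nat \<Rightarrow> (nat \<Rightarrow> nat \<Rightarrow> bool) \<Rightarrow> bool" where
  "contains m n M k l A \<longleftrightarrow>
     (\<exists>f g. strict_mono_on {..<k} f \<and> f ` {..<k} \<subseteq> {..<m} \<and>
            strict_mono_on {..<l} g \<and> g ` {..<l} \<subseteq> {..<n} \<and>
            (\<forall>i<k. \<forall>j<l. A i j \<longrightarrow> M (f i) (g j)))"

definition weight :: "nat \<Rightarrow> nat \<Rightarrow> (nat \<Rightarrow> nat \<Rightarrow> bool) \<Rightarrow> nat" where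
  "weight m n M = card {(i, j). i < m \<and> j < n \<and> M i j}"

definition ex :: "nat \<Rightarrow> nat \<Rightarrow> nat \<Rightarrow> (nat \<Rightarrow> nat \<Rightarrow> bool) \<Rightarrow> nat" where
  "ex n k l A = Sup {weight n n M | M. \<not> contains n n M k l A}"

definition column_partite :: "nat \<Rightarrow> nat \<Rightarrow> nat \<Rightarrow> (nat \<Rightarrow> nat \<Rightarrow> bool) \<Rightarrow> bool" where
  "column_partite t k l A \<longleftrightarrow>
     (\<exists>c :: nat \<Rightarrow> nat. c 0 = 0 \<and> c t = l \<and> (\<forall>s<t. c s \<le> c (Suc s)) \<and>
        (\<forall>s<t. \<forall>i<k. card {j. c s \<le> j \<and> j < c (Suc s) \<and> A i j} \<le> 1))"

end

theory Submission
  imports Defs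
begin

text \<open>View the rows as leaves of a \<open>K\<close>-ary tree of constant height \<open>h\<close>, with \<open>n \<le> K ^ h\<close>. For a
  \<open>t\<close>-tuple of columns let \<open>S\<close> be the set of its common rows. At most \<open>k ^ h\<close> rows of \<open>S\<close> have no
  ancestor with more than \<open>k\<close> children meeting \<open>S\<close>. If the matrix has more than \<open>C n ^ (2 - 1/t)\<close>
  ones, averaging yields a row \<open>r\<close> of degree at least \<open>\<surd>n\<close> such that most increasing \<open>t\<close>-tuples
  of columns in its neighbourhood do have such a branching ancestor of \<open>r\<close>. By pigeonhole, a fraction
  of order \<open>K ^ (-k)\<close> of these tuples branch at the same ancestor into the same \<open>k\<close> children, and for
  \<open>h\<close> large this density is enough to find a complete \<open>t\<close>-partite family of such tuples. Its parts are
  consecutive blocks of columns; embedding the \<open>i\<close>-th row of \<open>A\<close> into the \<open>i\<close>-th child keeps the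
  order of the rows. This gives the bound \<open>O(n ^ (2 - 1/t))\<close>.\<close>

section \<open>Nonbranching rows in the tree of rows\<close>

text \<open>The numbers \<open>x div K ^ j\<close> name the tree nodes at height \<open>j\<close>.\<close>

definition branches :: "nat \<Rightarrow> nat \<Rightarrow> nat \<Rightarrow> nat set \<Rightarrow> nat \<Rightarrow> bool" where
  "branches K k j S r \<longleftrightarrow>
     k < card ((\<lambda>x. x div K ^ j) ` {x \<in> S. x div K ^ Suc j = r div K ^ Suc j})"

text \<open>Each tree node above a nonbranching row has at most \<open>k\<close> children meeting
  \<open>S\<close>. Hence each level down multiplies the number of nodes meeting the nonbranching
  rows by at most \<open>k\<close>, starting from a single root at height \<open>h\<close>.\<close>

lemma card_nonbranching_le:
  assumes "S \<subseteq> {..<K ^ h}"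
  shows "card {r \<in> S. \<forall>j<h. \<not> branches K k j S r} \<le> k ^ h"
proof -
  define R where "R = {r \<in> S. \<forall>j<h. \<not> branches K k j S r}"
  have fin: "finite S" using assms finite_subset by blast
  have finR: "finite R" using fin by (simp add: R_def)
  have "card ((\<lambda>x. x div K ^ j) ` R) \<le> k ^ (h - j)" if "j \<le> h" for j
    using that
  \<comment> \<open>The induction descends from the root at \<open>j = h\<close> to the leaves at
    \<open>j = 0\<close>, where \<open>x div K ^ 0 = x\<close> and the nodes are the rows
    themselves.\<close>
  proof (induction j rule: inc_induct)
    case base
    have "(\<lambda>x. x div K ^ h) ` R \<subseteq> {0}" using assms by (auto simp: R_def)
    then have "card ((\<lambda>x. x div K ^ h) ` R) \<le> card {0::nat}" by (rule card_mono[rotated]) simp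
    then show ?case by simp
  next
    case (step j)
    let ?I = "(\<lambda>x. x div K ^ Suc j) ` R"
    let ?F = "\<lambda>q. (\<lambda>x. x div K ^ j) ` {x \<in> R. x div K ^ Suc j = q}"
    have "(\<lambda>x. x div K ^ j) ` R = (\<Union>q\<in>?I. ?F q)" by auto
    then have "card ((\<lambda>x. x div K ^ j) ` R) \<le> (\<Sum>q\<in>?I. card (?F q))"
      using card_UN_le[of ?I ?F] finR by simp
    also have "\<dots> \<le> (\<Sum>q\<in>?I. k)"
    proof (rule sum_mono)
      fix q assume "q \<in> ?I"
      then obtain r where r: "r \<in> R" "q = r div K ^ Suc j" by auto
      have "card (?F q) \<le> card ((\<lambda>x. x div K ^ j) ` {x \<in> S. x div K ^ Suc j = r div K ^ Suc j})"
        using fin r by (intro card_mono) (auto simp: R_def)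
      also have "\<dots> \<le> k" using r step.hyps by (auto simp: R_def branches_def not_less)
      finally show "card (?F q) \<le> k" .
    qed
    also have "\<dots> \<le> k ^ (h - Suc j) * k" using step.IH by simp
    also have "\<dots> = k ^ (h - j)"
      using step.hyps by (metis Suc_diff_Suc power_Suc2)
    finally show ?case .
  qed
  from this[of 0] show ?thesis by (simp add: R_def)
qed

section \<open>Complete t-partite families in dense sets of tuples\<close>

text \<open>A form of Erdos' theorem on complete \<open>t\<close>-partite hypergraphs. The required \<open>card V\<close> must be
  polynomial in \<open>1 / e\<close>, as \<open>e\<close> will be a small negative power of \<open>n\<close>.\<close>

lemma dense_tuples_contain_product:
  fixes L t :: nat
  assumes "L > 0"
  shows "\<exists>D. \<exists>c>0. \<forall>(V::'a set) G (e::real).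
     finite V \<longrightarrow> G \<subseteq> {xs. length xs = t \<and> set xs \<subseteq> V} \<longrightarrow> 0 < e \<longrightarrow> e \<le> 1 \<longrightarrow>
     e * real (card V) ^ t \<le> real (card G) \<longrightarrow> 1 \<le> c * e ^ D * real (card V) \<longrightarrow>
     (\<exists>C. (\<forall>s<t. C s \<subseteq> V \<and> card (C s) = L) \<and>
          (\<forall>xs. length xs = t \<longrightarrow> (\<forall>s<t. xs ! s \<in> C s) \<longrightarrow> xs \<in> G))"
proof (induction t)
  case 0
  show ?case
  proof (rule exI[of _ 0], rule exI[of _ "1::real"], intro conjI allI impI)
    fix V :: "'a set" and G and e :: real
    assume "G \<subseteq> {xs. length xs = 0 \<and> set xs \<subseteq> V}" "0 < e" "e * real (card V) ^ 0 \<le> real (card G)"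
    then have "G \<noteq> {}" "G \<subseteq> {[]}" by auto
    then show "\<exists>C. (\<forall>s<0. C s \<subseteq> V \<and> card (C s) = L) \<and>
          (\<forall>xs. length xs = 0 \<longrightarrow> (\<forall>s<0. xs ! s \<in> C s) \<longrightarrow> xs \<in> G)" by auto
  qed simp
next
  case (Suc t)
  then obtain D c where c: "c > (0::real)" and IH: "\<And>(V::'a set) G (e::real).
     finite V \<Longrightarrow> G \<subseteq> {xs. length xs = t \<and> set xs \<subseteq> V} \<Longrightarrow> 0 < e \<Longrightarrow> e \<le> 1 \<Longrightarrow>
     e * real (card V) ^ t \<le> real (card G) \<Longrightarrow> 1 \<le> c * e ^ D * real (card V) \<Longrightarrow>
     (\<exists>C. (\<forall>s<t. C s \<subseteq> V \<and> card (C s) = L) \<and>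
          (\<forall>xs. length xs = t \<longrightarrow> (\<forall>s<t. xs ! s \<in> C s) \<longrightarrow> xs \<in> G))" by blast
  \<comment> \<open>The first argument of the \<open>min\<close> in \<open>c'\<close> provides the
    size condition of the induction hypothesis at the smaller density
    \<open>e' = (e / (2 * L)) ^ (L + 1)\<close>. The second, together with the extra 1 in
    \<open>D'\<close>, gives \<open>L \<le> e / 2 * N\<close>.\<close>
  define D' where "D' = (L + 1) * D + 1"
  define c' where "c' = min (c / (2 * real L) ^ ((L + 1) * D)) (1 / (2 * real L))"
  have c': "c' > 0" using c assms by (simp add: c'_def)
  show ?case
  proof (rule exI[of _ D'], rule exI[of _ c'], intro conjI allI impI)
    show "c' > 0" by (rule c')
    fix V :: "'a set" and G and e :: real
    assume V: "finite V" and G: "G \<subseteq> {xs. length xs = Suc t \<and> set xs \<subseteq> V}" and e: "0 < e" "e \<le> 1"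
      and cG: "e * real (card V) ^ Suc t \<le> real (card G)" and big: "1 \<le> c' * e ^ D' * real (card V)"
    define N where "N = card V"
    have N: "N > 0" using big by (auto simp: N_def intro: Nat.gr0I)
    define W where "W = {xs. length xs = t \<and> set xs \<subseteq> V}"
    have finW: "finite W" using V finite_lists_length_eq[of V t] by (simp add: W_def conj_commute)
    have cardW: "card W = N ^ t" using V card_lists_length_eq[of V t] by (simp add: W_def N_def conj_commute)
    define d where "d x = {y \<in> V. y # x \<in> G}" for x
    have find: "finite (d x)" for x using V by (simp add: d_def)
    have Gsum: "card G = (\<Sum>x\<in>W. card (d x))"
    proof -
      have "G = (\<lambda>(x, y). y # x) ` (SIGMA x:W. d x)"
      proof (intro equalityI subsetI)
        fix z assume z: "z \<in> G"
        with G obtain y x where "z = y # x" "length x = t" "set x \<subseteq> V" "y \<in> V"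
          by (cases z) auto
        with z have "(x, y) \<in> (SIGMA x:W. d x)" by (auto simp: W_def d_def)
        then show "z \<in> (\<lambda>(x, y). y # x) ` (SIGMA x:W. d x)" using \<open>z = y # x\<close> by force
      qed (auto simp: d_def)
      moreover have "inj_on (\<lambda>(x, y). y # x) (SIGMA x:W. d x)" by (auto simp: inj_on_def)
      ultimately have "card G = card (SIGMA x:W. d x)" by (simp add: card_image)
      then show ?thesis using finW find by simp
    qed
    \<comment> \<open>Tails with at least \<open>e / 2 * N\<close> possible heads. The remaining
      tails account for at most half of the \<open>e * N ^ Suc t\<close> tuples that
      \<open>G\<close> is known to have, so \<open>H\<close> is large.\<close>
    define H where "H = {x \<in> W. e / 2 * N \<le> card (d x)}"
    have finH: "finite H" using finW by (simp add: H_def)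
    have dN: "card (d x) \<le> N" for x unfolding d_def N_def using V by (intro card_mono) auto
    have cardH: "e / 2 * real N ^ t \<le> card H"
    proof -
      have "e * real N ^ Suc t \<le> (\<Sum>x\<in>W. real (card (d x)))" using cG Gsum by (simp add: N_def)
      also have "\<dots> \<le> (\<Sum>x\<in>W. e / 2 * N + (if x \<in> H then real N else 0))"
        using dN e by (intro sum_mono) (auto simp: H_def intro: order_trans[of _ "real N"])
      also have "\<dots> = e / 2 * real N ^ Suc t + real N * card H"
        using finW by (simp add: sum.distrib cardW H_def sum.If_cases Int_def conj_ac)
      finally have "real N * (e / 2 * real N ^ t) \<le> real N * card H" by (simp add: algebra_simps)
      then show ?thesis using N by simp
    qed
    have eN: "real L \<le> e / 2 * N"
    proof -
      have "1 \<le> c' * e ^ D' * real N" using big by (simp add: N_def)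
      also have "\<dots> \<le> 1 / (2 * real L) * e ^ 1 * real N"
        using e by (intro mult_right_mono mult_mono power_decreasing) (auto simp: c'_def D'_def)
      finally show ?thesis using assms by (simp add: field_simps)
    qed
    define P where "P = {Y. Y \<subseteq> V \<and> card Y = L}"
    have finP: "finite P" using V by (simp add: P_def)
    define X where "X Y = {x \<in> H. Y \<subseteq> d x}" for Y
    define e' where "e' = (e / (2 * real L)) ^ (L + 1)"
    \<comment> \<open>Double counting of pairs \<open>(x, Y)\<close> with \<open>x\<close> in
      \<open>H\<close> and \<open>Y\<close> an \<open>L\<close>-subset of \<open>d x\<close>: each
      \<open>x\<close> has at least \<open>(e * N / (2 * L)) ^ L\<close> such \<open>Y\<close>,
      while at most \<open>N ^ L\<close> sets \<open>Y\<close> exist. The ratio gives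
      \<open>L\<close> of the factors in \<open>e'\<close>; the last one comes from
      \<open>e / 2 \<ge> e / (2 * L)\<close>.\<close>
    have "\<exists>Y\<in>P. e' * real N ^ t \<le> card (X Y)"
    proof (rule ccontr)
      assume "\<not> ?thesis"
      then have less: "card (X Y) < e' * real N ^ t" if "Y \<in> P" for Y using that by force
      have "card V \<ge> L" using eN e N
        by (smt (verit) N_def mult_left_le_one_le field_sum_of_halves of_nat_0_le_iff of_nat_le_iff)
      then obtain Y0 where "Y0 \<subseteq> V" "card Y0 = L" by (meson obtain_subset_with_card_n)
      then have "P \<noteq> {}" by (auto simp: P_def)
      have "(e / 2 * real N ^ t) * (e * N / (2 * real L)) ^ L \<le> card H * (e * N / (2 * real L)) ^ L"
        using cardH e by (intro mult_right_mono) auto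
      also have "\<dots> = (\<Sum>x\<in>H. (e * N / (2 * real L)) ^ L)" by simp
      also have "\<dots> \<le> (\<Sum>x\<in>H. real (card {Y\<in>P. Y \<subseteq> d x}))"
      proof (rule sum_mono)
        fix x assume x: "x \<in> H"
        have Ld: "e / 2 * N \<le> card (d x)" using x by (simp add: H_def)
        then have L: "L \<le> card (d x)" using eN by linarith
        have "(e * N / (2 * real L)) ^ L \<le> (real (card (d x)) / real L) ^ L"
          using divide_right_mono[OF Ld, of "real L"] e by (intro power_mono) simp_all
        also have "\<dots> \<le> real (card (d x) choose L)"
          using binomial_ge_n_over_k_pow_k[OF L, where 'a=real] by simp
        also have "card (d x) choose L = card {Y. Y \<subseteq> d x \<and> card Y = L}"
          using n_subsets[OF find] by simp
        also have "{Y. Y \<subseteq> d x \<and> card Y = L} = {Y\<in>P. Y \<subseteq> d x}" by (auto simp: P_def d_def)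
        finally show "(e * N / (2 * real L)) ^ L \<le> real (card {Y\<in>P. Y \<subseteq> d x})" .
      qed
      also have "\<dots> = (\<Sum>Y\<in>P. real (card (X Y)))"
        using sum.swap_restrict[OF finH finP, of "\<lambda>x Y. 1::real" "\<lambda>x Y. Y \<subseteq> d x"]
        by (simp add: X_def)
      also have "\<dots> < (\<Sum>Y\<in>P. e' * real N ^ t)"
        using less \<open>P \<noteq> {}\<close> finP by (intro sum_strict_mono) auto
      also have "\<dots> = real (card P) * (e' * real N ^ t)" by simp
      also have "card P = N choose L" using n_subsets[OF V, of L] by (simp add: P_def N_def)
      also have "real (N choose L) * (e' * real N ^ t) \<le> real (N ^ L) * (e' * real N ^ t)"
        using e \<open>card V \<ge> L\<close> binomial_le_pow[of L N]
        by (intro mult_right_mono) (auto simp: e'_def N_def simp flip: of_nat_power)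
      finally have "(e / 2) * (e / (2 * real L)) ^ L * (real N ^ L * real N ^ t)
          < e' * (real N ^ L * real N ^ t)"
        by (simp add: power_mult_distrib power_divide mult_ac)
      then have "(e / 2) * (e / (2 * real L)) ^ L < e'" by (rule mult_right_less_imp_less) simp
      moreover have "e' \<le> (e / 2) * (e / (2 * real L)) ^ L"
        unfolding e'_def power_add using e assms
        by (simp add: field_simps)
      ultimately show False by simp
    qed
    then obtain Y where Y: "Y \<in> P" "e' * real N ^ t \<le> card (X Y)" by blast
    have "\<exists>C. (\<forall>s<t. C s \<subseteq> V \<and> card (C s) = L) \<and>
          (\<forall>xs. length xs = t \<longrightarrow> (\<forall>s<t. xs ! s \<in> C s) \<longrightarrow> xs \<in> X Y)"
    proof (rule IH[of V "X Y" e'])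
      show "X Y \<subseteq> {xs. length xs = t \<and> set xs \<subseteq> V}" by (auto simp: X_def H_def W_def)
      show "0 < e'" using e assms by (simp add: e'_def)
      show "e' \<le> 1" unfolding e'_def using e assms by (intro power_le_one) (auto simp: field_simps)
      have "1 \<le> c' * e ^ D' * real N" using big by (simp add: N_def)
      also have "\<dots> \<le> c / (2 * real L) ^ ((L + 1) * D) * e ^ ((L + 1) * D) * real N"
        using e c by (intro mult_right_mono mult_mono power_decreasing) (auto simp: c'_def D'_def)
      also have "\<dots> = c * e' ^ D * N" unfolding e'_def by (simp only: power_divide power_mult) simp
      finally show "1 \<le> c * e' ^ D * card V" by (simp add: N_def)
    qed (use V Y in \<open>auto simp: N_def\<close>)
    then obtain C where C: "\<And>s. s < t \<Longrightarrow> C s \<subseteq> V \<and> card (C s) = L"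
      "\<And>xs. length xs = t \<Longrightarrow> (\<forall>s<t. xs ! s \<in> C s) \<Longrightarrow> xs \<in> X Y" by blast
    show "\<exists>C. (\<forall>s<Suc t. C s \<subseteq> V \<and> card (C s) = L) \<and>
          (\<forall>xs. length xs = Suc t \<longrightarrow> (\<forall>s<Suc t. xs ! s \<in> C s) \<longrightarrow> xs \<in> G)"
    \<comment> \<open>The popular set of heads \<open>Y\<close> becomes the first part, in front of
      the parts found for the tails.\<close>
    proof (intro exI[of _ "case_nat Y C"] conjI allI impI)
      fix s assume "s < Suc t"
      then show "case_nat Y C s \<subseteq> V" "card (case_nat Y C s) = L"
        using C(1) Y(1) by (auto simp: P_def split: nat.split)
    next
      fix xs assume "length xs = Suc t" and xs: "\<forall>s<Suc t. xs ! s \<in> case_nat Y C s"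
      then obtain y x where yx: "xs = y # x" "length x = t" by (auto simp: length_Suc_conv)
      have "y \<in> Y" using xs yx by (auto dest: spec[of _ 0])
      moreover have "x ! s \<in> C s" if "s < t" for s
        using xs[rule_format, of "Suc s"] yx that by simp
      then have "x \<in> X Y" using C(2)[OF yx(2)] by blast
      ultimately show "xs \<in> G" using yx by (auto simp: X_def d_def)
    qed
  qed
qed

section \<open>Embedding the matrix into blocks of columns\<close>

text \<open>By \<open>incr\<close> the sets \<open>C s\<close> lie from left to right, so the
  \<open>s\<close>-th interval of columns of \<open>A\<close> can be placed in \<open>C s\<close>. A
  row of \<open>A\<close> has at most one 1-entry per interval, so its 1-entries fall into a single
  transversal tuple, which \<open>rows\<close> realizes over any prescribed value in
  \<open>Q\<close>. Monotonicity of \<open>\<phi>\<close> then orders the chosen rows.\<close>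

lemma contains_of_blocks:
  assumes A: "column_partite t k l A" and \<phi>: "mono (\<phi> :: nat \<Rightarrow> nat)"
    and Q: "finite Q" "card Q = k"
    and C: "\<And>s. s < t \<Longrightarrow> C s \<subseteq> {..<n}" "\<And>s. s < t \<Longrightarrow> card (C s) = Suc l"
    and incr: "\<And>xs. length xs = t \<Longrightarrow> (\<forall>s<t. xs ! s \<in> C s) \<Longrightarrow> sorted_wrt (<) xs"
    and rows: "\<And>xs q. length xs = t \<Longrightarrow> (\<forall>s<t. xs ! s \<in> C s) \<Longrightarrow> q \<in> Q \<Longrightarrow>
      \<exists>x<m. \<phi> x = q \<and> (\<forall>y\<in>set xs. M x y)"
  shows "contains m n M k l A"
proof -
  obtain b :: "nat \<Rightarrow> nat" where b: "b 0 = 0" "b t = l"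
    "\<And>s i. s < t \<Longrightarrow> i < k \<Longrightarrow> card {j. b s \<le> j \<and> j < b (Suc s) \<and> A i j} \<le> 1"
    using A by (auto simp: column_partite_def)
  define cs where "cs s = sorted_list_of_set (C s)" for s
  have finC: "finite (C s)" if "s < t" for s using C(1)[OF that] finite_subset by blast
  have cs: "set (cs s) = C s" "length (cs s) = Suc l" "sorted_wrt (<) (cs s)" if "s < t" for s
    using finC[OF that] C(2)[OF that] by (auto simp: cs_def)
  have cs_nth: "cs s ! p \<in> C s" if "s < t" "p \<le> l" for s p
    using cs(1,2)[OF that(1)] that(2) by (metis le_imp_less_Suc nth_mem)
  \<comment> \<open>Index of the interval holding column \<open>j\<close>. Taking the least index
    gives \<open>b (blk j) \<le> j\<close>, by minimality or, for index 0, by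
    \<open>b 0 = 0\<close>.\<close>
  define blk where "blk j = (LEAST s. j < b (Suc s))" for j
  have blk: "blk j < t" "b (blk j) \<le> j" "j < b (Suc (blk j))" if jl: "j < l" for j
  proof -
    obtain t' where t': "t = Suc t'" using b jl by (cases t) auto
    have j: "j < b (Suc t')" using b t' jl by simp
    show "j < b (Suc (blk j))" unfolding blk_def using j by (rule LeastI)
    have "blk j \<le> t'" unfolding blk_def using j by (rule Least_le)
    then show "blk j < t" using t' by simp
    show "b (blk j) \<le> j"
    proof (cases "blk j")
      case (Suc s)
      then have "\<not> j < b (Suc s)" unfolding blk_def by (intro not_less_Least) simp
      then show ?thesis using Suc by simp
    qed (use b in simp)
  qed
  define g where "g j = cs (blk j) ! (j - b (blk j))" for j
  have g: "g j \<in> C (blk j)" if "j < l" for j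
    using cs_nth[of "blk j"] blk[OF that] that by (simp add: g_def)
  \<comment> \<open>Any two elements of different parts extend to a transversal tuple. The other
    entries are filled with first elements, which exist even for \<open>l = 0\<close> since the
    parts have size \<open>Suc l\<close>.\<close>
  have C_less: "x < y" if "s < s'" "s' < t" "x \<in> C s" "y \<in> C s'" for s s' x y
  proof -
    define xs where "xs = map (\<lambda>u. if u = s then x else if u = s' then y else cs u ! 0) [0..<t]"
    have "sorted_wrt (<) xs" using that cs_nth by (intro incr) (auto simp: xs_def)
    then have "xs ! s < xs ! s'" 
      by (rule sorted_wrt_nth_less[OF _ that(1)]) (use that in \<open>simp add: xs_def\<close>)
    then show ?thesis using that by (simp add: xs_def)
  qed
  have gmono: "strict_mono_on {..<l} g"
  proof (rule strict_mono_onI)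
    fix i j assume ij: "i \<in> {..<l}" "j \<in> {..<l}" "i < j"
    have "blk i \<le> blk j" unfolding blk_def[of i]
      using ij blk(3)[of j] by (intro Least_le) auto
    then consider "blk i = blk j" | "blk i < blk j" by linarith
    then show "g i < g j"
    proof cases
      case 1
      then show ?thesis using cs(2,3)[of "blk i"] blk(1,2)[of i] blk(2)[of j] ij
        unfolding g_def by (auto simp: sorted_wrt_iff_nth_less)
    next
      case 2
      then show ?thesis using C_less[OF 2 _ g g] blk(1)[of j] ij by simp
    qed
  qed
  define qs where "qs = sorted_list_of_set Q"
  have qs: "length qs = k" "set qs = Q" "sorted_wrt (<) qs" using Q by (auto simp: qs_def)
  have "\<exists>x<m. \<phi> x = qs ! i \<and> (\<forall>j<l. A i j \<longrightarrow> M x (g j))" if i: "i < k" for i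
  proof -
    \<comment> \<open>The transversal for row \<open>i\<close>: in block \<open>s\<close> the image
      of the column holding its only 1-entry there, or an arbitrary filler if there is none.\<close>
    define a where "a s = (if \<exists>j. b s \<le> j \<and> j < b (Suc s) \<and> j < l \<and> blk j = s \<and> A i j
       then g (SOME j. b s \<le> j \<and> j < b (Suc s) \<and> j < l \<and> blk j = s \<and> A i j) else cs s ! 0)" for s
    have "a s \<in> C s" if "s < t" for s
    proof (cases "\<exists>j. b s \<le> j \<and> j < b (Suc s) \<and> j < l \<and> blk j = s \<and> A i j")
      case True
      then show ?thesis unfolding a_def using g someI_ex[OF True] by (metis (lifting))
    next
      case False
      then show ?thesis unfolding a_def using cs_nth that by (auto simp: False)
    qed
    then obtain x where x: "x < m" "\<phi> x = qs ! i" "\<forall>y\<in>set (map a [0..<t]). M x y"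
      using rows[of "map a [0..<t]" "qs ! i"] qs i nth_mem[of i qs] by auto
    have "a (blk j) = g j" if j: "j < l" "A i j" for j
    proof -
      let ?P = "\<lambda>j'. b (blk j) \<le> j' \<and> j' < b (Suc (blk j)) \<and> j' < l \<and> blk j' = blk j \<and> A i j'"
      have P: "?P j" using j blk[of j] by simp
      then have S: "?P (SOME j'. ?P j')" by (rule someI)
      have "j1 = j2" if "?P j1" "?P j2" for j1 j2
      proof -
        have "finite {j'. b (blk j) \<le> j' \<and> j' < b (Suc (blk j)) \<and> A i j'}"
          by (rule finite_subset[of _ "{..<b (Suc (blk j))}"]) auto
        then show ?thesis using b(3)[of "blk j" i] blk(1)[of j] i j that
          by (auto simp: card_le_Suc0_iff_eq)
      qed
      then have "(SOME j'. ?P j') = j" using P S by blast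
      then show ?thesis using P by (auto simp: a_def)
    qed
    then have "g j \<in> set (map a [0..<t])" if "j < l" "A i j" for j
      using that blk(1)[of j] by (metis atLeast0LessThan image_eqI lessThan_iff set_map set_upt)
    then show ?thesis using x by blast
  qed
  then obtain f where f: "\<And>i. i < k \<Longrightarrow> f i < m \<and> \<phi> (f i) = qs ! i \<and> (\<forall>j<l. A i j \<longrightarrow> M (f i) (g j))"
    by metis
  have fmono: "strict_mono_on {..<k} f"
  proof (rule strict_mono_onI)
    fix i j assume ij: "i \<in> {..<k}" "j \<in> {..<k}" "i < j"
    then have "\<phi> (f i) < \<phi> (f j)" using f qs by (auto simp: sorted_wrt_iff_nth_less)
    then show "f i < f j" using \<phi> by (meson linorder_not_less monoD)
  qed
  have "g ` {..<l} \<subseteq> {..<n}" using g C(1) blk(1) by blast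
  then show ?thesis unfolding contains_def using fmono gmono f by blast
qed

section \<open>Degree power sums of an avoiding matrix\<close>

lemma card_increasing_lists:
  assumes "finite (V :: nat set)"
  shows "card {xs. length xs = t \<and> set xs \<subseteq> V \<and> sorted_wrt (<) xs} = card V choose t"
proof -
  have "bij_betw set {xs. length xs = t \<and> set xs \<subseteq> V \<and> sorted_wrt (<) xs} {X. X \<subseteq> V \<and> card X = t}"
  proof (rule bij_betw_byWitness[where f' = sorted_list_of_set])
    show "sorted_list_of_set ` {X. X \<subseteq> V \<and> card X = t}
        \<subseteq> {xs. length xs = t \<and> set xs \<subseteq> V \<and> sorted_wrt (<) xs}"
    proof clarify
      fix X assume "X \<subseteq> V" "t = card X"
      with finite_subset[OF this(1) assms]
      show "length (sorted_list_of_set X) = card X \<and> set (sorted_list_of_set X) \<subseteq> V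
          \<and> sorted_wrt (<) (sorted_list_of_set X)" by simp
    qed
    show "\<forall>X\<in>{X. X \<subseteq> V \<and> card X = t}. set (sorted_list_of_set X) = X"
      using finite_subset[OF _ assms] by (metis (no_types, lifting) mem_Collect_eq set_sorted_list_of_set)
  qed (auto simp: sorted_list_of_set.idem_if_sorted_distinct strict_sorted_iff distinct_card)
  from bij_betw_same_card[OF this] show ?thesis using n_subsets[OF assms] by simp
qed

text \<open>Rows of degree below \<open>sqrt n\<close> contribute the first term. For any other row
  fewer than half of the \<open>(d r / t) ^ t\<close> guaranteed tuples branch, so its contribution
  is at most twice its number of nonbranching tuples; in total these are at most
  \<open>k ^ h\<close> for each tuple of columns. The hypothesis \<open>big\<close> makes degrees of
  at least \<open>sqrt n\<close> large enough for \<open>dense\<close>.\<close>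

lemma power_sum_le_of_avoiding:
  fixes c :: real and K h n :: nat
  assumes A: "column_partite t k l A" and avoid: "\<not> contains n n M k l A"
    and t: "t > 0" "t\<^sup>2 \<le> n" and h: "h > 0" "n \<le> K ^ h"
    and dense: "\<And>(V::nat set) G (e::real).
     finite V \<Longrightarrow> G \<subseteq> {xs. length xs = t \<and> set xs \<subseteq> V} \<Longrightarrow> 0 < e \<Longrightarrow> e \<le> 1 \<Longrightarrow>
     e * real (card V) ^ t \<le> real (card G) \<Longrightarrow> 1 \<le> c * e ^ D * real (card V) \<Longrightarrow>
     (\<exists>C. (\<forall>s<t. C s \<subseteq> V \<and> card (C s) = Suc l) \<and>
          (\<forall>xs. length xs = t \<longrightarrow> (\<forall>s<t. xs ! s \<in> C s) \<longrightarrow> xs \<in> G))"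
    and big: "\<And>N::nat. n \<le> N\<^sup>2 \<Longrightarrow> 1 \<le> c * (1 / (2 * real t ^ t * real h * real K ^ k)) ^ D * real N"
  defines "d \<equiv> \<lambda>r. card {y. y < n \<and> M r y}"
  shows "(\<Sum>r<n. (real (d r) / real t) ^ t) \<le> real n * (sqrt n / real t) ^ t + 2 * (real k ^ h * real n ^ t)"
proof -
  define Tup where "Tup = {xs. length xs = t \<and> set xs \<subseteq> {..<n} \<and> sorted_wrt (<) xs}"
  define S where "S xs = {x. x < n \<and> (\<forall>y\<in>set xs. M x y)}" for xs
  define T where "T r = {xs \<in> Tup. r \<in> S xs}" for r
  define Br where "Br r = {xs \<in> T r. \<exists>j<h. branches K k j (S xs) r}" for r
  define NB where "NB r = {xs \<in> T r. \<forall>j<h. \<not> branches K k j (S xs) r}" for r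
  have "Tup \<subseteq> {xs. set xs \<subseteq> {..<n} \<and> length xs = t}" by (auto simp: Tup_def)
  from finite_subset[OF this] card_mono[OF _ this]
  have finTup: "finite Tup" and cardTup: "card Tup \<le> n ^ t"
    using finite_lists_length_eq[of "{..<n}" t] card_lists_length_eq[of "{..<n}" t] by auto
  have finS: "finite (S xs)" for xs by (simp add: S_def)
  have cardT: "card (T r) = d r choose t" if "r < n" for r
  proof -
    have "T r = {xs. length xs = t \<and> set xs \<subseteq> {y. y < n \<and> M r y} \<and> sorted_wrt (<) xs}"
      using that by (auto simp: T_def Tup_def S_def)
    then show ?thesis by (simp add: card_increasing_lists d_def)
  qed
  have finT: "finite (T r)" for r using finTup by (simp add: T_def)
  have T_split: "card (T r) = card (Br r) + card (NB r)" for r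
  proof -
    have "T r = Br r \<union> NB r" "Br r \<inter> NB r = {}" by (auto simp: Br_def NB_def)
    then show ?thesis using finT by (metis card_Un_disjoint finite_Un)
  qed
  have "(\<Sum>r<n. card (NB r)) = (\<Sum>xs\<in>Tup. card {r \<in> S xs. \<forall>j<h. \<not> branches K k j (S xs) r})"
  proof -
    have "(\<Sum>r<n. card (NB r)) = (\<Sum>r<n. \<Sum>xs\<in>{xs\<in>Tup. r \<in> S xs \<and> (\<forall>j<h. \<not> branches K k j (S xs) r)}. 1)"
      by (simp add: NB_def T_def conj_assoc)
    also have "\<dots> = (\<Sum>xs\<in>Tup. \<Sum>r\<in>{r\<in>{..<n}. r \<in> S xs \<and> (\<forall>j<h. \<not> branches K k j (S xs) r)}. 1)"
      by (rule sum.swap_restrict) (use finTup in auto)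
    also have "\<dots> = (\<Sum>xs\<in>Tup. card {r \<in> S xs. \<forall>j<h. \<not> branches K k j (S xs) r})"
      by (intro sum.cong refl) (auto simp: S_def intro: arg_cong[of _ _ card])
    finally show ?thesis .
  qed
  also have "\<dots> \<le> (\<Sum>xs\<in>Tup. k ^ h)"
    using h by (intro sum_mono card_nonbranching_le) (auto simp: S_def)
  also have "\<dots> \<le> n ^ t * k ^ h" using cardTup by simp
  finally have NB_sum: "(\<Sum>r<n. card (NB r)) \<le> n ^ t * k ^ h" .

  \<comment> \<open>Otherwise pigeonhole over pairs of a height \<open>j\<close> and a
    \<open>k\<close>-set \<open>Q\<close> of children yields a dense family of tuples branching into
    the same children, and \<open>A\<close> embeds.\<close>
  have Br_less: "card (Br r) < 1 / 2 * (d r / t) ^ t" if r: "r < n" "n \<le> (d r)\<^sup>2" for r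
  proof (rule ccontr)
    assume "\<not> ?thesis"
    then have Br: "1 / 2 * (d r / t) ^ t \<le> card (Br r)" by simp
    have K: "K > 0" using h r by (cases "K = 0") (simp_all add: power_0_left)
    define V where "V = {y. y < n \<and> M r y}"
    define G where "G = (\<lambda>(j, Q). {xs \<in> T r. Q \<subseteq> (\<lambda>x. x div K ^ j) ` S xs})"
    \<comment> \<open>The \<open>K\<close> children, at height \<open>j\<close>, of the ancestor of
      \<open>r\<close> at height \<open>Suc j\<close>.\<close>
    define I where "I j = {K * (r div K ^ Suc j)..<K * (r div K ^ Suc j) + K}" for j
    define P where "P = (SIGMA j:{..<h}. {Q. Q \<subseteq> I j \<and> card Q = k})"
    have finI: "finite (I j)" for j by (simp add: I_def)
    have finP: "finite P" using finI by (auto simp: P_def)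
    have cardP: "real (card P) \<le> real h * real K ^ k"
    proof -
      have "card P = h * (K choose k)"
        using n_subsets[OF finI] finI by (simp add: P_def I_def)
      moreover have "K choose k \<le> K ^ k"
        by (cases "k \<le> K") (auto intro: binomial_le_pow simp: binomial_eq_0)
      ultimately have "card P \<le> h * K ^ k" by simp
      then show ?thesis by (metis of_nat_le_iff of_nat_mult of_nat_power)
    qed
    have "Br r \<subseteq> (\<Union>p\<in>P. G p)"
    proof
      fix xs assume "xs \<in> Br r"
      then obtain j where j: "xs \<in> T r" "j < h" "branches K k j (S xs) r" by (auto simp: Br_def)
      let ?Z = "(\<lambda>x. x div K ^ j) ` {x \<in> S xs. x div K ^ Suc j = r div K ^ Suc j}"
      have "?Z \<subseteq> I j"
      proof
        fix y assume "y \<in> ?Z"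
        then obtain x where "y = x div K ^ j" "x div K ^ Suc j = r div K ^ Suc j" by blast
        then have "y div K = r div K ^ Suc j" by (metis div_mult2_eq power_Suc2)
        then show "y \<in> I j" unfolding I_def using K
          by (metis atLeastLessThan_iff dividend_less_times_div times_div_less_eq_dividend add.commute)
      qed
      moreover obtain Q where "Q \<subseteq> ?Z" "card Q = k"
        using j(3) obtain_subset_with_card_n[of k ?Z] by (auto simp: branches_def)
      ultimately have "(j, Q) \<in> P" "xs \<in> G (j, Q)" using j by (auto simp: P_def G_def)
      then show "xs \<in> (\<Union>p\<in>P. G p)" by blast
    qed
    then have "card (Br r) \<le> card (\<Union>p\<in>P. G p)"
      using finP finT by (intro card_mono) (auto simp: G_def)
    also have "\<dots> \<le> (\<Sum>p\<in>P. card (G p))" using finP by (rule card_UN_le)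
    finally have BrG: "card (Br r) \<le> (\<Sum>p\<in>P. card (G p))" .
    \<comment> \<open>Half of \<open>(d r / t) ^ t\<close>, shared among at most
      \<open>h * K ^ k\<close> pairs, leaves \<open>e * d r ^ t\<close> tuples for one of
      them.\<close>
    define e where "e = 1 / (2 * real t ^ t * real h * real K ^ k)"
    have e: "e > 0" using t h K by (simp add: e_def)
    have dr: "d r > 0" using r by (auto intro: Nat.gr0I)
    have "\<exists>p\<in>P. e * real (d r) ^ t \<le> card (G p)"
    proof (rule ccontr)
      assume "\<not> ?thesis"
      then have less: "real (card (G p)) < e * real (d r) ^ t" if "p \<in> P" for p
        using that by force
      have "1 / 2 * (d r / t) ^ t > 0" using dr t by simp
      then have "P \<noteq> {}" using Br BrG by auto
      have "1 / 2 * (d r / t) ^ t \<le> (\<Sum>p\<in>P. real (card (G p)))"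
        using Br of_nat_mono[OF BrG, where 'a=real] by simp
      also have "\<dots> < (\<Sum>p\<in>P. e * real (d r) ^ t)"
        using less finP \<open>P \<noteq> {}\<close> by (intro sum_strict_mono) auto
      also have "\<dots> = real (card P) * (e * real (d r) ^ t)" by simp
      also have "\<dots> \<le> real h * real K ^ k * (e * real (d r) ^ t)"
        using cardP e by (intro mult_right_mono) auto
      also have "\<dots> = 1 / 2 * (d r / t) ^ t"
        using h K t by (simp add: e_def power_divide)
      finally show False by simp
    qed
    then obtain j Q where jQ: "j < h" "Q \<subseteq> I j" "card Q = k" "e * real (d r) ^ t \<le> card (G (j, Q))"
      by (auto simp: P_def)
    have "\<exists>C. (\<forall>s<t. C s \<subseteq> V \<and> card (C s) = Suc l) \<and>
          (\<forall>xs. length xs = t \<longrightarrow> (\<forall>s<t. xs ! s \<in> C s) \<longrightarrow> xs \<in> G (j, Q))"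
    proof (rule dense[of V _ e])
      show "G (j, Q) \<subseteq> {xs. length xs = t \<and> set xs \<subseteq> V}"
        by (auto simp: G_def T_def Tup_def S_def V_def)
      have "1 \<le> 2 * real t ^ t * real h * real K ^ k"
      proof -
        have "1 \<le> 2 * t ^ t * h * K ^ k" using t h K by (simp add: Suc_leI)
        then have "real 1 \<le> real (2 * t ^ t * h * K ^ k)" by (simp only: of_nat_le_iff)
        then show ?thesis by simp
      qed
      then show "e \<le> 1" unfolding e_def by (subst divide_le_eq_1) linarith
      show "1 \<le> c * e ^ D * real (card V)" using big[OF r(2)] by (simp add: e_def V_def d_def)
    qed (use e jQ in \<open>auto simp: V_def d_def\<close>)
    then obtain C where C: "\<And>s. s < t \<Longrightarrow> C s \<subseteq> V \<and> card (C s) = Suc l"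
          "\<And>xs. length xs = t \<Longrightarrow> (\<forall>s<t. xs ! s \<in> C s) \<Longrightarrow> xs \<in> G (j, Q)" by blast
    have "contains n n M k l A"
    proof (rule contains_of_blocks[OF A, of "\<lambda>x. x div K ^ j" Q C])
      show "mono (\<lambda>x. x div K ^ j)" by (simp add: mono_def div_le_mono)
      show "finite Q" using jQ(2) finI finite_subset by blast
      show "C s \<subseteq> {..<n}" if "s < t" for s using C(1)[OF that] by (auto simp: V_def)
      show "sorted_wrt (<) xs" if "length xs = t" "\<forall>s<t. xs ! s \<in> C s" for xs
        using C(2)[OF that] by (auto simp: G_def T_def Tup_def)
      show "\<exists>x<n. x div K ^ j = q \<and> (\<forall>y\<in>set xs. M x y)"
        if "length xs = t" "\<forall>s<t. xs ! s \<in> C s" "q \<in> Q" for xs q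
        using C(2)[OF that(1,2)] that(3) by (auto simp: G_def S_def)
    qed (use jQ C in auto)
    then show False using avoid by simp
  qed

  have "(\<Sum>r<n. (d r / t) ^ t) \<le> (\<Sum>r<n. (sqrt n / t) ^ t + 2 * real (card (NB r)))"
  proof (rule sum_mono)
    fix r assume r: "r \<in> {..<n}"
    show "(d r / t) ^ t \<le> (sqrt n / t) ^ t + 2 * real (card (NB r))"
    proof (cases "n \<le> (d r)\<^sup>2")
      case True
      then have "t \<le> d r" using t(2) by (meson order_trans power2_nat_le_eq_le)
      then have "(d r / t) ^ t \<le> real (d r choose t)"
        using binomial_ge_n_over_k_pow_k[of t "d r", where 'a=real] by simp
      also have "\<dots> = real (card (Br r)) + card (NB r)" using cardT[of r] T_split[of r] r by simp
      also have "\<dots> \<le> 1 / 2 * (d r / t) ^ t + card (NB r)" using Br_less[of r] r True by simp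
      finally have "(d r / t) ^ t \<le> 2 * real (card (NB r))" by simp
      moreover have "0 \<le> (sqrt n / t) ^ t" by simp
      ultimately show ?thesis by linarith
    next
      case False
      then have "real (d r) ^ 2 \<le> n" by (metis nat_le_linear of_nat_le_iff of_nat_power)
      then have "real (d r) \<le> sqrt n" by (rule real_le_rsqrt)
      then have "(d r / t) ^ t \<le> (sqrt n / t) ^ t" by (intro power_mono divide_right_mono) auto
      then show ?thesis by simp
    qed
  qed
  also have "\<dots> = n * (sqrt n / t) ^ t + 2 * real (\<Sum>r<n. card (NB r))"
    by (simp add: sum.distrib sum_distrib_left)
  also have "\<dots> \<le> n * (sqrt n / t) ^ t + 2 * real (n ^ t * k ^ h)"
    using NB_sum by (metis add_left_mono mult_left_mono of_nat_le_iff zero_le_numeral)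
  finally show ?thesis by (simp add: mult.commute)
qed

section \<open>From degree powers to weights and extremal numbers\<close>

text \<open>Truncation at \<open>x = n powr (1 - 1 / t)\<close>: a degree above \<open>x\<close> is
  at most \<open>d r ^ t / x ^ (t - 1)\<close>. This threshold gives both \<open>n * x\<close> and
  \<open>n ^ t / x ^ (t - 1)\<close> the order \<open>n powr (2 - 1 / t)\<close>.\<close>

lemma sum_le_of_power_sum_le:
  fixes d :: "nat \<Rightarrow> nat" and B :: real
  assumes t: "t > 0" and n: "n > 0" and B: "(\<Sum>r<n. real (d r) ^ t) \<le> B * real n ^ t"
  shows "real (\<Sum>r<n. d r) \<le> (1 + B) * real n powr (2 - 1 / t)"
proof -
  define x where "x = real n powr (1 - 1 / t)"
  have x: "x > 0" using n by (simp add: x_def)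
  have "real (d r) \<le> x + real (d r) ^ t / x ^ (t - 1)" for r
  proof (cases "real (d r) \<le> x")
    case False
    have "real (d r) * x ^ (t - 1) \<le> real (d r) * real (d r) ^ (t - 1)"
      using False x by (intro mult_left_mono power_mono) auto
    also have "\<dots> = real (d r) ^ t" using t by (metis power_minus_mult mult.commute)
    finally have "real (d r) \<le> real (d r) ^ t / x ^ (t - 1)" using x by (simp add: pos_le_divide_eq)
    then show ?thesis using x by linarith
  qed (use x in \<open>simp add: add_increasing2\<close>)
  then have "real (\<Sum>r<n. d r) \<le> (\<Sum>r<n. x + real (d r) ^ t / x ^ (t - 1))"
    unfolding of_nat_sum by (rule sum_mono)
  also have "\<dots> = n * x + (\<Sum>r<n. real (d r) ^ t) / x ^ (t - 1)"
    by (simp add: sum.distrib sum_divide_distrib)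
  also have "\<dots> \<le> n * x + B * real n ^ t / x ^ (t - 1)"
    using B x by (intro add_left_mono divide_right_mono) auto
  also have "n * x = real n powr (2 - 1 / t)"
    using n by (simp add: x_def powr_mult_base)
  also have "B * real n ^ t / x ^ (t - 1) = B * real n powr (2 - 1 / t)"
  proof -
    have "real n ^ t = real n powr t" using n by (simp add: powr_realpow)
    moreover have "x ^ (t - 1) = real n powr ((1 - 1 / t) * (real t - 1))"
      unfolding x_def using n t by (subst powr_realpow[symmetric]) (simp_all add: powr_powr of_nat_diff)
    ultimately have "real n ^ t / x ^ (t - 1) = real n powr (real t - (1 - 1 / t) * (real t - 1))"
      by (simp add: powr_diff)
    also have "real t - (1 - 1 / t) * (real t - 1) = 2 - 1 / t"
      using t by (simp add: field_simps)
    finally show ?thesis by (metis times_divide_eq_right)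
  qed
  finally show ?thesis by (simp add: algebra_simps)
qed

lemma weight_eq_sum: "weight m n M = (\<Sum>r<m. card {y. y < n \<and> M r y})"
proof -
  have "{(i, j). i < m \<and> j < n \<and> M i j} = (SIGMA r:{..<m}. {y. y < n \<and> M r y})" by auto
  then show ?thesis by (simp add: weight_def)
qed

text \<open>A uniform bound makes the set of weights finite, so that its \<open>Sup\<close> is an
  attained maximum. If every matrix contains \<open>A\<close>, the set is empty and its
  \<open>Sup\<close> is 0, which \<open>b \<ge> 0\<close> covers.\<close>

lemma ex_le:
  assumes "\<And>M. \<not> contains n n M k l A \<Longrightarrow> real (weight n n M) \<le> b" "b \<ge> 0"
  shows "real (ex n k l A) \<le> b"
proof -
  let ?W = "{weight n n M | M. \<not> contains n n M k l A}"
  have "finite ?W"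
  proof (rule finite_subset)
    show "?W \<subseteq> {..nat \<lfloor>b\<rfloor>}" using assms by (auto simp: le_nat_floor)
  qed simp
  show ?thesis
  proof (cases "?W = {}")
    case True
    then show ?thesis unfolding ex_def True using assms by (simp add: Sup_nat_def)
  next
    case False
    with \<open>finite ?W\<close> have "Max ?W \<in> ?W" by (rule Max_in)
    then have "real (Max ?W) \<le> b" using assms by force
    then show ?thesis unfolding ex_def Sup_nat_def using False by simp
  qed
qed

section \<open>Choice of parameters and the final exponent\<close>

text \<open>Rounding the \<open>h\<close>-th root of \<open>n\<close> up to the least possible
  \<open>K\<close> at most doubles it: \<open>K \<ge> 2\<close> gives
  \<open>K \<le> 2 * (K - 1)\<close>, and \<open>(K - 1) ^ h\<close> is still below
  \<open>n\<close>.\<close>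

lemma exists_root_bound:
  fixes n h :: nat
  assumes "n \<ge> 2" "h > 0"
  shows "\<exists>K. n \<le> K ^ h \<and> K ^ h \<le> 2 ^ h * n"
proof -
  define K where "K = (LEAST K. n \<le> K ^ h)"
  have "n \<le> n ^ h" using assms by (simp add: self_le_power)
  then have K: "n \<le> K ^ h" unfolding K_def by (rule LeastI)
  have K2: "K \<ge> 2"
  proof (rule ccontr)
    assume "\<not> K \<ge> 2"
    then have "K ^ h \<le> 1" by (intro power_le_one) auto
    then show False using K assms by linarith
  qed
  have "\<not> n \<le> (K - 1) ^ h" unfolding K_def using K2 by (intro not_less_Least) (simp add: K_def)
  then have "(K - 1) ^ h \<le> n" by simp
  have "K ^ h \<le> (2 * (K - 1)) ^ h" using K2 by (intro power_mono) auto
  also have "\<dots> \<le> 2 ^ h * n" using \<open>(K - 1) ^ h \<le> n\<close> by (simp add: power_mult_distrib)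
  finally show ?thesis using K by blast
qed

lemma ex_column_partite_le:
  assumes t: "t \<ge> 2" and A: "column_partite t k l A"
  shows "\<exists>B n0. \<forall>n\<ge>n0. real (ex n k l A) \<le> B * real n powr (2 - 1 / t)"
proof -
  obtain D c where c: "c > (0::real)" and dense: "\<forall>(V::nat set) G (e::real).
     finite V \<longrightarrow> G \<subseteq> {xs. length xs = t \<and> set xs \<subseteq> V} \<longrightarrow> 0 < e \<longrightarrow> e \<le> 1 \<longrightarrow>
     e * real (card V) ^ t \<le> real (card G) \<longrightarrow> 1 \<le> c * e ^ D * real (card V) \<longrightarrow>
     (\<exists>C. (\<forall>s<t. C s \<subseteq> V \<and> card (C s) = Suc l) \<and>
          (\<forall>xs. length xs = t \<longrightarrow> (\<forall>s<t. xs ! s \<in> C s) \<longrightarrow> xs \<in> G))"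
    using dense_tuples_contain_product[OF zero_less_Suc[of l], of t, where 'a = nat]
    by (elim exE conjE) (rule that)
  \<comment> \<open>The density is of order \<open>K ^ (-k)\<close> and enters with exponent
    \<open>D\<close>, so degrees of order \<open>K ^ (k * D)\<close> are required. With this
    \<open>h\<close> the square of that is \<open>K ^ h / K\<close>, which is below \<open>n\<close>
    by a factor of order \<open>K\<close>.\<close>
  define h where "h = 2 * k * D + 1"
  \<comment> \<open>With this \<open>b\<close> the condition \<open>big\<close> reads
    \<open>b * K ^ (k * D) \<le> N\<close>.\<close>
  define b where "b = (2 * real t ^ t * real h) ^ D / c"
  have h: "h > 0" by (simp add: h_def)
  then have b: "b > 0" using t c by (simp add: b_def)
  \<comment> \<open>From \<open>n \<ge> b0 ^ h\<close> follows \<open>K \<ge> b0\<close>, so the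
    spare factor \<open>K\<close> absorbs the constant \<open>2 ^ h * b\<^sup>2\<close>.\<close>
  define b0 where "b0 = nat \<lceil>2 ^ h * b\<^sup>2\<rceil>"
  define B where "B = 1 + 2 * real k ^ h * real t ^ t"
  show ?thesis
  proof (intro exI[of _ "1 + B"] exI[of _ "b0 ^ h + t\<^sup>2 + 2"] allI impI)
    fix n assume "n \<ge> b0 ^ h + t\<^sup>2 + 2"
    then have n: "n \<ge> b0 ^ h" "t\<^sup>2 \<le> n" "n \<ge> 2" by auto
    obtain K where K: "n \<le> K ^ h" "K ^ h \<le> 2 ^ h * n" using exists_root_bound[OF n(3) h] by blast
    have K0: "K > 0" using K(1) h n(3) by (cases "K = 0") (simp_all add: power_0_left)
    have "b0 \<le> K"
    proof (rule ccontr)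
      assume "\<not> b0 \<le> K"
      then have "K ^ h < b0 ^ h" using h by (intro power_strict_mono) auto
      then show False using K(1) n(1) by linarith
    qed
    then have Kb: "2 ^ h * b\<^sup>2 \<le> K" by (simp add: b0_def nat_le_iff ceiling_le_iff)
    have big: "1 \<le> c * (1 / (2 * real t ^ t * real h * real K ^ k)) ^ D * real N" if N: "n \<le> N\<^sup>2" for N
    proof -
      have "2 ^ h * (b * real K ^ (k * D))\<^sup>2 = (2 ^ h * b\<^sup>2) * real K ^ (2 * k * D)"
        by (simp add: power_mult_distrib power_mult[symmetric] mult_ac)
      also have "\<dots> \<le> real K * real K ^ (2 * k * D)" using Kb by (intro mult_right_mono) auto
      also have "\<dots> = real (K ^ h)" by (simp add: h_def)
      also have "\<dots> \<le> real (2 ^ h * N\<^sup>2)" using K(2) N by (meson mult_le_mono2 of_nat_le_iff order_trans)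
      finally have "(b * real K ^ (k * D))\<^sup>2 \<le> (real N)\<^sup>2" by simp
      then have "b * real K ^ (k * D) \<le> real N" by (rule power2_le_imp_le) simp
      moreover have "b * real K ^ (k * D) > 0" using b K0 by simp
      ultimately have "1 \<le> real N / (b * real K ^ (k * D))" by simp
      then show ?thesis by (simp add: b_def power_mult_distrib power_divide mult_ac flip: power_mult)
    qed
    show "real (ex n k l A) \<le> (1 + B) * real n powr (2 - 1 / t)"
    proof (rule ex_le)
      fix M assume M: "\<not> contains n n M k l A"
      define d where "d r = card {y. y < n \<and> M r y}" for r
      have "(\<Sum>r<n. (real (d r) / t) ^ t) \<le> n * (sqrt n / t) ^ t + 2 * (real k ^ h * real n ^ t)"
        unfolding d_def
        by (rule power_sum_le_of_avoiding[OF A M _ n(2) h K(1) dense[rule_format] big]) (use t in auto)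
      then have "(\<Sum>r<n. real (d r) ^ t) \<le> n * sqrt n ^ t + 2 * (real k ^ h * real n ^ t) * t ^ t"
        using t by (simp add: power_divide field_simps flip: sum_divide_distrib)
      \<comment> \<open>Here \<open>t \<ge> 2\<close> is used in full: the rows of small degree stay
        within \<open>n ^ t\<close> because \<open>t + 2 \<le> 2 * t\<close>. They account for the 1
        in \<open>B\<close>.\<close>
      also have "n * sqrt n ^ t \<le> real n ^ t"
      proof -
        have "n * sqrt n ^ t = sqrt n ^ (t + 2)" by (simp add: power_add power2_eq_square)
        also have "\<dots> \<le> sqrt n ^ (2 * t)" using t n(3) by (intro power_increasing) auto
        also have "\<dots> = real n ^ t" by (simp add: power_mult)
        finally show ?thesis .
      qed
      finally have "(\<Sum>r<n. real (d r) ^ t) \<le> B * real n ^ t" by (simp add: B_def algebra_simps)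
      then show "real (weight n n M) \<le> (1 + B) * real n powr (2 - 1 / t)"
        using sum_le_of_power_sum_le[of t n d B] t n(3) by (simp add: weight_eq_sum d_def)
    qed (simp add: B_def)
  qed
qed

theorem theorem1p1:
  fixes t k l :: nat and A :: "nat \<Rightarrow> nat \<Rightarrow> bool"
  assumes "t \<ge> 2" and "column_partite t k l A"
  shows "\<forall>\<epsilon>>0. \<exists>n0. \<forall>n\<ge>n0.
           real (ex n k l A) < real n powr (2 - 1 / real t + 1 / (2 * real t ^ 2) + \<epsilon>)"
proof (intro allI impI)
  fix \<epsilon> :: real assume "\<epsilon> > 0"
  \<comment> \<open>The surplus of the claimed exponent over \<open>2 - 1 / t\<close>. Being
    positive, it absorbs the constant \<open>B\<close> once \<open>n\<close> is large.\<close>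
  define \<delta> where "\<delta> = 1 / (2 * real t ^ 2) + \<epsilon>"
  have \<delta>: "\<delta> > 0" using \<open>\<epsilon> > 0\<close> by (simp add: \<delta>_def add_nonneg_pos)
  obtain B n0 where B: "\<And>n. n \<ge> n0 \<Longrightarrow> real (ex n k l A) \<le> B * real n powr (2 - 1 / t)"
    using ex_column_partite_le[OF assms] by blast
  \<comment> \<open>Chosen so that \<open>N powr \<delta>\<close> exceeds
    \<open>\<bar>B\<bar> + 1\<close>; the absolute value keeps the base positive whatever the sign
    of \<open>B\<close>.\<close>
  obtain N :: nat where N: "(\<bar>B\<bar> + 1) powr (1 / \<delta>) < N" using reals_Archimedean2 by blast
  have B_less: "B < real n powr \<delta>" if "n \<ge> N" for n
  proof -
    have "((\<bar>B\<bar> + 1) powr (1 / \<delta>)) powr \<delta> < real n powr \<delta>"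
      using N that \<delta> by (intro powr_less_mono2) auto
    moreover have "((\<bar>B\<bar> + 1) powr (1 / \<delta>)) powr \<delta> = \<bar>B\<bar> + 1"
      using \<delta> by (simp add: powr_powr)
    ultimately show ?thesis by linarith
  qed
  show "\<exists>n0. \<forall>n\<ge>n0.
           real (ex n k l A) < real n powr (2 - 1 / real t + 1 / (2 * real t ^ 2) + \<epsilon>)"
  proof (intro exI[of _ "N + n0 + 1"] allI impI)
    fix n assume n: "n \<ge> N + n0 + 1"
    have "real (ex n k l A) \<le> B * real n powr (2 - 1 / t)" using n by (intro B) simp
    also have "\<dots> < real n powr \<delta> * real n powr (2 - 1 / t)"
      using n by (intro mult_strict_right_mono B_less) auto
    also have "\<dots> = real n powr (2 - 1 / real t + 1 / (2 * real t ^ 2) + \<epsilon>)"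
      by (simp add: \<delta>_def powr_add[symmetric] algebra_simps)
    finally show "real (ex n k l A) < real n powr (2 - 1 / real t + 1 / (2 * real t ^ 2) + \<epsilon>)" .
  qed
qed

end
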